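(* Let $(\mathcal{F}_n)_{n\ge0}$ be a filtration. Let $(B_n^* )_{n\ge1}$ be nonnegative random variables (base bets), predictable with respect to $(\mathcal{F}_n)_{n\ge0}$. For each $n\ge1$ let $B_n^\circ\ge1$ be the total amount bet at coup $n$ when the base bet is one unit, $R_n^\circ\ge0$ the corresponding return, and $X_n^\circ=R_n^\circ-B_n^\circ$ the corresponding profit. Assume that each of the sequences $(B_n^\circ,R_n^\circ)_{n\ge1}$ and $(B_n^\circ,X_n^\circ)_{n\ge1}$ is i.i.d. in $n$ and adapted to $(\mathcal{F}_n)_{n\ge0}$, with $(B_n^\circ,R_n^\circ)$ independent of $\mathcal{F}_{n-1}$ and $(B_n^\circ,X_n^\circ)$ independent of $\mathcal{F}_{n-1}$ for each $n\ge1$. Put $B_n=B_n^*B_n^\circ$, $R_n=B_n^*R_n^\circ$, $X_n=B_n^*X_n^\circ$, and $$\mathfrak{R}_n:=\frac{\sum_{k=1}^n R_k}{\sum_{k=1}^n B_k},\qquad \mathfrak{X}_n:=\frac{\sum_{k=1}^n X_k}{\sum_{k=1}^n B_k}.$$ Suppose that $$\sup_{n\ge1}\mathbb{E}[(B_n^* )^2]<\infty,\qquad\liminf_{n\to\infty}\frac1n\sum_{k=1}^n B_k^*>0\quad\text{a.s.},\qquad\text{and}\qquad\mathbb{E}[(B_1^\circ)^2]<\infty.$$ If $\mathbb{E}[(R_1^\circ)^2]<\infty$, or equivalently $\mathbb{E}[(X_1^\circ)^2]<\infty$, then $$\lim_{n\to\infty}\mathfrak{R}_n=\mathrm{RTP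}(B_1^\circ,R_1^\circ)\quad\text{a.s.}\qquad\text{and}\qquad\lim_{n\to\infty}\mathfrak{X}_n=-\mathrm{HA}(B_1^\circ,X_1^\circ)\quad\text{a.s.}$$
   Context: All random variables live on a common probability space. $\mathcal{F}_n$ is interpreted as the $\sigma$-algebra of all events known following the $n$th coup. In a compound game the base bet may be incremented during the coup by additional bets proportional to it; $B_n^\circ$ is the one-unit base bet plus any such increments (hence $B_n^\circ\ge1$). Predictable means $B_n^*$ is $\mathcal{F}_{n-1}$-measurable for every $n\ge1$. For a bet $B\ge0$, return $R\ge0$, and profit $X=R-B$, with $0<\mathbb{E}[B]<\infty$, $\mathbb{E}[R]<\infty$, $\mathbb{E}[|X|]<\infty$, $$\mathrm{RTP}(B,R):=\frac{\mathbb{E}[R]}{\mathbb{E}[B]},\qquad \mathrm{HA}(B,X):=-\frac{\mathbb{E}[X]}{\mathbb{E}[B]}.$$ Ratios are considered for $n$ large enough that the denominator is positive (which holds eventually, almost surely). *)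

theory Defs
  imports "HOL-Probability.Probability"
begin

(* Sequences indexed by n >= 1 are functions on nat whose value at 0 is never used. *)

definition filtration_of :: "'a measure \<Rightarrow> (nat \<Rightarrow> 'a measure) \<Rightarrow> bool" where
  "filtration_of M F \<longleftrightarrow> filtration (space M) F \<and> (\<forall>n. subalgebra M (F n))"

definition adapted :: "(nat \<Rightarrow> 'a measure) \<Rightarrow> (nat \<Rightarrow> 'a \<Rightarrow> 'b::topological_space) \<Rightarrow> bool" where
  "adapted F Z \<longleftrightarrow> (\<forall>n\<ge>1. Z n \<in> borel_measurable (F n))"

definition predictable :: "(nat \<Rightarrow> 'a measure) \<Rightarrow> (nat \<Rightarrow> 'a \<Rightarrow> 'b::topological_space) \<Rightarrow> bool" where
  "predictable F Z \<longleftrightarrow> (\<forall>n\<ge>1. Z n \<in> borel_measurable (F (n - 1)))"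

definition iid :: "'a measure \<Rightarrow> (nat \<Rightarrow> 'a \<Rightarrow> 'b::topological_space) \<Rightarrow> bool" where
  "iid M Z \<longleftrightarrow>
     prob_space.indep_vars M (\<lambda>_. borel) Z {1..} \<and>
     (\<forall>n\<ge>1. distr M borel (Z n) = distr M borel (Z 1))"

definition indep_of_algebra ::
  "'a measure \<Rightarrow> ('a \<Rightarrow> 'b::topological_space) \<Rightarrow> 'a measure \<Rightarrow> bool" where
  "indep_of_algebra M Z G \<longleftrightarrow>
     prob_space.indep_set M (sets (vimage_algebra (space M) Z borel)) (sets G)"

(* Second moment as an extended nonnegative real, so that E[Z^2] < \<infinity> is a genuine condition. *)
definition second_moment :: "'a measure \<Rightarrow> ('a \<Rightarrow> real) \<Rightarrow> ennreal" where
  "second_moment M Z = (\<integral>\<^sup>+\<omega>. ennreal ((Z \<omega>)\<^sup>2) \<partial>M)"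

(* Return to player and house advantage. Both are meaningful only for integrable arguments with
   positive expected bet; the Bochner integral and division are total. *)
definition RTP :: "'a measure \<Rightarrow> ('a \<Rightarrow> real) \<Rightarrow> ('a \<Rightarrow> real) \<Rightarrow> real" where
  "RTP M B R = prob_space.expectation M R / prob_space.expectation M B"

definition HA :: "'a measure \<Rightarrow> ('a \<Rightarrow> real) \<Rightarrow> ('a \<Rightarrow> real) \<Rightarrow> real" where
  "HA M B X = - (prob_space.expectation M X / prob_space.expectation M B)"

(* Cumulative amount per unit bet through coup n. When nothing has been bet so far the quotient
   is 0 by the convention x / 0 = 0, which does not affect limits if bets eventually occur. *)
definition cumulative_ratio ::
  "(nat \<Rightarrow> 'a \<Rightarrow> real) \<Rightarrow> (nat \<Rightarrow> 'a \<Rightarrow> real) \<Rightarrow> nat \<Rightarrow> 'a \<Rightarrow> real" where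
  "cumulative_ratio A B n \<omega> = (\<Sum>k=1..n. A k \<omega>) / (\<Sum>k=1..n. B k \<omega>)"

end

theory Submission
  imports Defs "HOL-Library.Discrete_Functions"
begin

text \<open>
For Z = Ro, Bo or Xo, the variables Bs n * (Z n - E[Z 1]) are uniformly bounded in L2 and pairwise
orthogonal, because Z n is independent of the past and Bs n is determined by it. Rajchman's strong
law for such sequences needs no maximal inequality: the second moments of the averages along the
squares m^2 are summable, and Cauchy-Schwarz on the block between m^2 and (m+1)^2, which has only
2m+1 terms, controls the averages in between. Dividing by the average base bet, which is eventually
bounded away from 0, turns the two laws for the numerator and for Bo into the limit of the ratio.
\<close>

section \<open>Strong law for orthogonal sequences bounded in L2\<close>

text \<open>Integrating the series termwise shows that its sum has finite integral, hence is finite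
  almost everywhere, and the terms of a convergent series vanish in the limit. This does the work of
  Chebyshev plus Borel-Cantelli without any threshold epsilon.\<close>

lemma AE_tendsto_zero_of_summable_integral:
  fixes W :: "nat \<Rightarrow> 'a \<Rightarrow> real"
  assumes int: "\<And>n. integrable M (W n)"
    and nonneg: "\<And>n x. x \<in> space M \<Longrightarrow> 0 \<le> W n x"
    and summ: "summable (\<lambda>n. \<integral>x. W n x \<partial>M)"
  shows "AE x in M. (\<lambda>n. W n x) \<longlonglongrightarrow> 0"
proof -
  have [measurable]: "W n \<in> borel_measurable M" for n
    using int by auto
  have nn: "0 \<le> (\<integral>x. W n x \<partial>M)" for n
    using nonneg by (intro integral_nonneg_AE) auto
  have "(\<integral>\<^sup>+x. (\<Sum>n. ennreal (W n x)) \<partial>M) = (\<Sum>n. \<integral>\<^sup>+x. ennreal (W n x) \<partial>M)"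
    by (intro nn_integral_suminf) auto
  also have "\<dots> = (\<Sum>n. ennreal (\<integral>x. W n x \<partial>M))"
    by (intro suminf_cong nn_integral_eq_integral int) (use nonneg in auto)
  also have "\<dots> = ennreal (\<Sum>n. \<integral>x. W n x \<partial>M)"
    using summ nn by (intro suminf_ennreal2) auto
  finally have "(\<integral>\<^sup>+x. (\<Sum>n. ennreal (W n x)) \<partial>M) \<noteq> \<infinity>"
    by simp
  then have "AE x in M. (\<Sum>n. ennreal (W n x)) \<noteq> \<infinity>"
    by (intro nn_integral_noteq_infinite) auto
  then show ?thesis
  proof (rule AE_mp, intro AE_I2 impI)
    fix x assume x: "x \<in> space M" and "(\<Sum>n. ennreal (W n x)) \<noteq> \<infinity>"
    then have "summable (\<lambda>n. W n x)"
      using nonneg by (intro summable_suminf_not_top) auto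
    then show "(\<lambda>n. W n x) \<longlonglongrightarrow> 0"
      by (rule summable_LIMSEQ_zero)
  qed
qed

text \<open>Pythagoras: after expanding the square only the diagonal survives. The point is growth
  linear in \<open>card I\<close>, where Cauchy-Schwarz alone would give quadratic growth and
  nothing summable.\<close>

lemma integral_sum_square_orthogonal_le:
  fixes D :: "nat \<Rightarrow> 'a \<Rightarrow> real"
  assumes fin: "finite I"
    and int: "\<And>i j. i \<in> I \<Longrightarrow> j \<in> I \<Longrightarrow> integrable M (\<lambda>x. D i x * D j x)"
    and orth: "\<And>i j. i \<in> I \<Longrightarrow> j \<in> I \<Longrightarrow> i \<noteq> j \<Longrightarrow> (\<integral>x. D i x * D j x \<partial>M) = 0"
    and bound: "\<And>i. i \<in> I \<Longrightarrow> (\<integral>x. (D i x)\<^sup>2 \<partial>M) \<le> C"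
  shows "integrable M (\<lambda>x. (\<Sum>i\<in>I. D i x)\<^sup>2)"
    and "(\<integral>x. (\<Sum>i\<in>I. D i x)\<^sup>2 \<partial>M) \<le> of_nat (card I) * C"
proof -
  have eq: "(\<lambda>x. (\<Sum>i\<in>I. D i x)\<^sup>2) = (\<lambda>x. \<Sum>i\<in>I. \<Sum>j\<in>I. D i x * D j x)"
    by (simp add: power2_eq_square sum_product)
  show "integrable M (\<lambda>x. (\<Sum>i\<in>I. D i x)\<^sup>2)"
    unfolding eq by (intro Bochner_Integration.integrable_sum int)
  have "(\<integral>x. (\<Sum>i\<in>I. D i x)\<^sup>2 \<partial>M) = (\<Sum>i\<in>I. \<Sum>j\<in>I. \<integral>x. D i x * D j x \<partial>M)"
    unfolding eq using int by (simp add: Bochner_Integration.integral_sum)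
  also have "\<dots> = (\<Sum>i\<in>I. \<Sum>j\<in>I. if i = j then \<integral>x. (D i x)\<^sup>2 \<partial>M else 0)"
    by (intro sum.cong refl) (auto simp: orth power2_eq_square)
  also have "\<dots> = (\<Sum>i\<in>I. \<integral>x. (D i x)\<^sup>2 \<partial>M)"
    using fin by simp
  also have "\<dots> \<le> of_nat (card I) * C"
    using bound by (intro sum_bounded_above) auto
  finally show "(\<integral>x. (\<Sum>i\<in>I. D i x)\<^sup>2 \<partial>M) \<le> of_nat (card I) * C" .
qed

lemma filterlim_floor_sqrt_at_top: "filterlim floor_sqrt at_top sequentially"
  unfolding filterlim_at_top
proof
  fix Z :: nat
  show "\<forall>\<^sub>F n in sequentially. Z \<le> floor_sqrt n"
    using eventually_ge_at_top[of "Z\<^sup>2"]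
    by eventually_elim (metis floor_sqrt_inverse_power2 mono_floor_sqrt')
qed

text \<open>Split at the last square m^2 below n. The remainder is enlarged to the whole block up to
  the next square, so that the bound depends on m alone, and the divisor n is replaced by the
  smaller m^2. Both terms are written as square roots of quantities over m^4 because the integrals
  of those quantities are what can be estimated.\<close>

lemma average_le_block_bounds:
  fixes d :: "nat \<Rightarrow> real"
  defines "s \<equiv> \<lambda>n. \<Sum>k=1..n. d k"
  assumes n: "1 \<le> n" and m: "m\<^sup>2 \<le> n" "n < (Suc m)\<^sup>2" "1 \<le> m"
  shows "\<bar>s n / n\<bar> \<le> sqrt ((s (m\<^sup>2))\<^sup>2 / real m ^ 4)
     + sqrt (real (2 * m + 1) * (\<Sum>k\<in>{m\<^sup>2<..(Suc m)\<^sup>2}. (d k)\<^sup>2) / real m ^ 4)"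
proof -
  let ?J = "{m\<^sup>2<..(Suc m)\<^sup>2}"
  have "{1..n} = {1..m\<^sup>2} \<union> {m\<^sup>2<..n}"
    using m by auto
  then have split: "s n = s (m\<^sup>2) + (\<Sum>k\<in>{m\<^sup>2<..n}. d k)"
    unfolding s_def by (metis (no_types) sum.union_disjoint finite_atLeastAtMost finite_greaterThanAtMost ivl_disj_int_two(8))
  have "\<bar>\<Sum>k\<in>{m\<^sup>2<..n}. d k\<bar> \<le> (\<Sum>k\<in>{m\<^sup>2<..n}. \<bar>d k\<bar>)"
    by (rule sum_abs)
  also have "\<dots> \<le> (\<Sum>k\<in>?J. \<bar>d k\<bar>)"
    using m by (intro sum_mono2) auto
  also have "\<dots> \<le> sqrt (real (card ?J) * (\<Sum>k\<in>?J. (d k)\<^sup>2))"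
    using sum_squared_le_sum_of_squares[of "\<lambda>k. \<bar>d k\<bar>" ?J]
    by (intro real_le_rsqrt) (simp add: mult.commute)
  also have "card ?J = 2 * m + 1"
    by (simp add: power2_eq_square)
  finally have tail: "\<bar>\<Sum>k\<in>{m\<^sup>2<..n}. d k\<bar> \<le> sqrt (real (2 * m + 1) * (\<Sum>k\<in>?J. (d k)\<^sup>2))" .
  have sq4: "sqrt (real m ^ 4) = real (m\<^sup>2)"
    using real_sqrt_abs[of "(real m)\<^sup>2"] by (simp flip: power_mult)
  have "\<bar>s n / n\<bar> \<le> \<bar>s n\<bar> / real (m\<^sup>2)"
    using m n by (simp add: frac_le del: of_nat_power)
  also have "\<dots> \<le> (\<bar>s (m\<^sup>2)\<bar> + sqrt (real (2 * m + 1) * (\<Sum>k\<in>?J. (d k)\<^sup>2))) / real (m\<^sup>2)"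
    using split tail by (intro divide_right_mono) auto
  also have "\<dots> = sqrt ((s (m\<^sup>2))\<^sup>2 / real m ^ 4)
     + sqrt (real (2 * m + 1) * (\<Sum>k\<in>?J. (d k)\<^sup>2) / real m ^ 4)"
    by (simp only: real_sqrt_divide sq4 real_sqrt_abs add_divide_distrib)
  finally show ?thesis .
qed

text \<open>Squares are sparse enough for the second moments of the averages to be summable, and
  dense enough for a block to have only O(m) terms, which is negligible against m^2.\<close>

theorem orthogonal_strong_law:
  fixes D :: "nat \<Rightarrow> 'a \<Rightarrow> real"
  assumes int: "\<And>i j. 1 \<le> i \<Longrightarrow> 1 \<le> j \<Longrightarrow> integrable M (\<lambda>x. D i x * D j x)"
    and orth: "\<And>i j. 1 \<le> i \<Longrightarrow> i < j \<Longrightarrow> (\<integral>x. D i x * D j x \<partial>M) = 0"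
    and bound: "\<And>i. 1 \<le> i \<Longrightarrow> (\<integral>x. (D i x)\<^sup>2 \<partial>M) \<le> C"
  shows "AE x in M. (\<lambda>n. (\<Sum>k=1..n. D k x) / real n) \<longlonglongrightarrow> 0"
proof -
  \<comment> \<open>\<open>W\<close> is the squared average at the square m^2; \<open>V\<close> is
    the squared Cauchy-Schwarz bound for the change within the following block, on the same scale.
    At m = 0 both are 0, since division by 0 yields 0.\<close>
  define W where "W m x = (\<Sum>k=1..m\<^sup>2. D k x)\<^sup>2 / real m ^ 4" for m x
  define V where "V m x = real (2 * m + 1) * (\<Sum>k\<in>{m\<^sup>2<..(Suc m)\<^sup>2}. (D k x)\<^sup>2) / real m ^ 4" for m x
  have orth': "(\<integral>x. D i x * D j x \<partial>M) = 0" if "1 \<le> i" "1 \<le> j" "i \<noteq> j" for i j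
    using orth[of i j] orth[of j i] that by (cases i j rule: linorder_cases) (auto simp: mult.commute)
  have int_sq: "integrable M (\<lambda>x. (D i x)\<^sup>2)" if "1 \<le> i" for i
    using int[OF that that] by (simp add: power2_eq_square)
  have C: "0 \<le> C"
    using bound[of 1] by (rule order_trans[rotated]) (auto intro!: integral_nonneg_AE)
  have "AE x in M. (\<lambda>m. W m x) \<longlonglongrightarrow> 0"
  proof (rule AE_tendsto_zero_of_summable_integral)
    show "integrable M (W m)" for m
      unfolding W_def using integral_sum_square_orthogonal_le(1)[of "{1..m\<^sup>2}" M D C] int orth' bound
      by auto
    show "0 \<le> W m x" for m x
      by (simp add: W_def)
    show "summable (\<lambda>m. \<integral>x. W m x \<partial>M)"
    proof (rule summable_comparison_test_ev)
      show "\<forall>\<^sub>F m in sequentially. norm (\<integral>x. W m x \<partial>M) \<le> C * (1 / real m ^ 2)"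
        using eventually_gt_at_top[of 0]
      proof eventually_elim
        fix m :: nat assume m: "0 < m"
        \<comment> \<open>There are m^2 orthogonal terms, each with second moment at most
          \<open>C\<close>, against the divisor m^4.\<close>
        have "(\<integral>x. W m x \<partial>M) \<le> real (m\<^sup>2) * C / real m ^ 4"
          unfolding W_def
          using integral_sum_square_orthogonal_le(2)[of "{1..m\<^sup>2}" M D C] int orth' bound
          by (auto intro!: divide_right_mono)
        also have "\<dots> = C * (1 / real m ^ 2)"
          using m by (simp add: field_simps eval_nat_numeral)
        finally show "norm (\<integral>x. W m x \<partial>M) \<le> C * (1 / real m ^ 2)"
          by (simp add: W_def integral_nonneg_AE)
      qed
      show "summable (\<lambda>m. C * (1 / real m ^ 2))"
        using inverse_power_summable[of 2, where 'a=real] by (intro summable_mult) (simp add: field_simps)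
    qed
  qed
  moreover have "AE x in M. (\<lambda>m. V m x) \<longlonglongrightarrow> 0"
  proof (rule AE_tendsto_zero_of_summable_integral)
    have int_block: "integrable M (\<lambda>x. \<Sum>k\<in>{m\<^sup>2<..(Suc m)\<^sup>2}. (D k x)\<^sup>2)" for m
      using int_sq by (intro Bochner_Integration.integrable_sum) auto
    show "integrable M (V m)" for m
      unfolding V_def using int_block by auto
    show "0 \<le> V m x" for m x
      by (simp add: V_def sum_nonneg)
    show "summable (\<lambda>m. \<integral>x. V m x \<partial>M)"
    proof (rule summable_comparison_test_ev)
      show "\<forall>\<^sub>F m in sequentially. norm (\<integral>x. V m x \<partial>M) \<le> (9 * C) * (1 / real m ^ 2)"
        using eventually_gt_at_top[of 0]
      proof eventually_elim
        fix m :: nat assume m: "0 < m"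
        have "(\<integral>x. (\<Sum>k\<in>{m\<^sup>2<..(Suc m)\<^sup>2}. (D k x)\<^sup>2) \<partial>M)
            = (\<Sum>k\<in>{m\<^sup>2<..(Suc m)\<^sup>2}. \<integral>x. (D k x)\<^sup>2 \<partial>M)"
          using int_sq by (intro Bochner_Integration.integral_sum) auto
        also have "\<dots> \<le> real (card {m\<^sup>2<..(Suc m)\<^sup>2}) * C"
          using bound by (intro sum_bounded_above) auto
        also have "card {m\<^sup>2<..(Suc m)\<^sup>2} = 2 * m + 1"
          by (simp add: power2_eq_square)
        \<comment> \<open>The block length is at most 3m for m > 0. It enters twice, once as the
          Cauchy-Schwarz factor in \<open>V\<close> and once as the number of second moments summed,
          whence the constant 9.\<close>
        also have "real (2 * m + 1) * C \<le> (3 * real m) * C"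
          using m C by (intro mult_right_mono) auto
        finally have le: "(\<integral>x. (\<Sum>k\<in>{m\<^sup>2<..(Suc m)\<^sup>2}. (D k x)\<^sup>2) \<partial>M) \<le> (3 * real m) * C" .
        have "real (2 * m + 1) * (\<integral>x. (\<Sum>k\<in>{m\<^sup>2<..(Suc m)\<^sup>2}. (D k x)\<^sup>2) \<partial>M)
            \<le> (3 * real m) * ((3 * real m) * C)"
          using m by (intro mult_mono le) (auto intro!: integral_nonneg_AE sum_nonneg)
        then have "(\<integral>x. V m x \<partial>M) \<le> (3 * real m) * ((3 * real m) * C) / real m ^ 4"
          unfolding V_def integral_divide_zero integral_mult_right_zero
          by (rule divide_right_mono) simp
        also have "\<dots> = (9 * C) * (1 / real m ^ 2)"
          using m by (simp add: field_simps eval_nat_numeral)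
        finally show "norm (\<integral>x. V m x \<partial>M) \<le> (9 * C) * (1 / real m ^ 2)"
          by (simp add: V_def integral_nonneg_AE sum_nonneg)
      qed
      show "summable (\<lambda>m. (9 * C) * (1 / real m ^ 2))"
        using inverse_power_summable[of 2, where 'a=real] by (intro summable_mult) (simp add: field_simps)
    qed
  qed
  ultimately show ?thesis
  proof eventually_elim
    fix x assume W: "(\<lambda>m. W m x) \<longlonglongrightarrow> 0" and V: "(\<lambda>m. V m x) \<longlonglongrightarrow> 0"
    have "(\<lambda>m. sqrt (W m x) + sqrt (V m x)) \<longlonglongrightarrow> 0"
      using tendsto_add[OF tendsto_real_sqrt[OF W] tendsto_real_sqrt[OF V]] by simp
    \<comment> \<open>\<open>floor_sqrt n\<close> is the index of the block that n falls in, so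
      convergence in m becomes convergence in n.\<close>
    then have "(\<lambda>n. sqrt (W (floor_sqrt n) x) + sqrt (V (floor_sqrt n) x)) \<longlonglongrightarrow> 0"
      by (rule filterlim_compose) (rule filterlim_floor_sqrt_at_top)
    then show "(\<lambda>n. (\<Sum>k=1..n. D k x) / real n) \<longlonglongrightarrow> 0"
    proof (rule Lim_null_comparison[rotated])
      show "\<forall>\<^sub>F n in sequentially. norm ((\<Sum>k=1..n. D k x) / real n)
          \<le> sqrt (W (floor_sqrt n) x) + sqrt (V (floor_sqrt n) x)"
        using eventually_ge_at_top[of 1]
      proof eventually_elim
        fix n :: nat assume n: "1 \<le> n"
        have "1 \<le> floor_sqrt n"
          using n mono_floor_sqrt'[of 1 n] by simp
        then show "norm ((\<Sum>k=1..n. D k x) / real n)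
          \<le> sqrt (W (floor_sqrt n) x) + sqrt (V (floor_sqrt n) x)"
          unfolding W_def V_def real_norm_def
          using n Suc_floor_sqrt_power2_gt by (intro average_le_block_bounds) auto
      qed
    qed
  qed
qed

section \<open>Independence from a sigma-algebra, and second moments\<close>

text \<open>Composition can only shrink the generated sigma-algebra. This passes from the pairs in
  the hypotheses to their coordinates.\<close>

lemma indep_of_algebra_comp:
  assumes "prob_space M" and indep: "indep_of_algebra M Z G" and f: "f \<in> borel_measurable borel"
  shows "indep_of_algebra M (\<lambda>\<omega>. f (Z \<omega>)) G"
proof -
  interpret prob_space M by fact
  have "sets (vimage_algebra (space M) (\<lambda>\<omega>. f (Z \<omega>)) borel) \<subseteq> sets (vimage_algebra (space M) Z borel)"
    using measurable_vimage_algebra1[of Z "space M" borel]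
    by (intro sets_image_in_sets measurable_compose[OF _ f]) auto
  then show ?thesis
    using indep unfolding indep_of_algebra_def indep_sets2_eq by blast
qed

text \<open>Everything generated by \<open>U\<close> already lies in \<open>G\<close>. The result is
  put in terms of \<open>indep_var\<close> because the product rule for expectations is stated for
  that notion.\<close>

lemma (in prob_space) indep_var_of_algebra:
  assumes indep: "indep_of_algebra M Z G" and G: "subalgebra M G"
    and U: "U \<in> borel_measurable G" and Z: "Z \<in> borel_measurable M"
  shows "indep_var borel U borel Z"
proof -
  have U_sub: "sets (vimage_algebra (space M) U borel) \<subseteq> sets G"
    using G U by (intro sets_image_in_sets) (auto simp: subalgebra_def)
  have U_M: "U \<in> borel_measurable M"
    using G U by (rule measurable_from_subalg)
  have "indep_set (sets (vimage_algebra (space M) U borel)) (sets (vimage_algebra (space M) Z borel))"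
    unfolding indep_sets2_eq
  proof (intro conjI ballI)
    show "sets (vimage_algebra (space M) U borel) \<subseteq> events"
      using U_sub G by (auto simp: subalgebra_def)
    show "sets (vimage_algebra (space M) Z borel) \<subseteq> events"
      using indep unfolding indep_of_algebra_def indep_sets2_eq by blast
    fix a b
    assume a: "a \<in> sets (vimage_algebra (space M) U borel)" and b: "b \<in> sets (vimage_algebra (space M) Z borel)"
    have "prob (b \<inter> a) = prob b * prob a"
      using indep unfolding indep_of_algebra_def by (rule indep_setD) (use a b U_sub in blast)+
    then show "prob (a \<inter> b) = prob a * prob b"
      by (subst Int_commute, subst mult.commute)
  qed
  then show ?thesis
    unfolding indep_var_eq sets_vimage_algebra using U_M Z by simp
qed

lemma second_moment_finite_iff:
  assumes "Z \<in> borel_measurable M"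
  shows "second_moment M Z < \<infinity> \<longleftrightarrow> integrable M (\<lambda>\<omega>. (Z \<omega>)\<^sup>2)"
  using assms unfolding second_moment_def integrable_iff_bounded by simp

text \<open>The product is dominated by the sum of the two squares, by the inequality of arithmetic
  and geometric means.\<close>

lemma integrable_mult_of_square_integrable:
  fixes f g :: "'a \<Rightarrow> real"
  assumes [measurable]: "f \<in> borel_measurable M" "g \<in> borel_measurable M"
    and "integrable M (\<lambda>x. (f x)\<^sup>2)" "integrable M (\<lambda>x. (g x)\<^sup>2)"
  shows "integrable M (\<lambda>x. f x * g x)"
proof (rule Bochner_Integration.integrable_bound)
  show "integrable M (\<lambda>x. (f x)\<^sup>2 + (g x)\<^sup>2)"
    using assms by auto
  show "AE x in M. norm (f x * g x) \<le> norm ((f x)\<^sup>2 + (g x)\<^sup>2)"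
  proof (intro AE_I2)
    fix x
    have "2 * (\<bar>f x\<bar> * \<bar>g x\<bar>) \<le> (f x)\<^sup>2 + (g x)\<^sup>2"
      using sum_squares_bound[of "\<bar>f x\<bar>" "\<bar>g x\<bar>"] by simp
    moreover have "0 \<le> \<bar>f x\<bar> * \<bar>g x\<bar>"
      by simp
    ultimately have "\<bar>f x\<bar> * \<bar>g x\<bar> \<le> (f x)\<^sup>2 + (g x)\<^sup>2"
      by linarith
    then show "norm (f x * g x) \<le> norm ((f x)\<^sup>2 + (g x)\<^sup>2)"
      by (simp add: abs_mult)
  qed
qed simp

section \<open>Strong law with predictable multipliers\<close>

text \<open>The centred terms are martingale differences in L2: at each time the multiplier is known
  from the past while the centred \<open>Z\<close> is independent of it. This provides the
  orthogonality and the uniform bound that \<open>orthogonal_strong_law\<close> asks for.\<close>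

theorem (in prob_space) strong_law_predictable_multiplier:
  fixes H Z :: "nat \<Rightarrow> 'a \<Rightarrow> real"
  assumes filt: "filtration_of M F"
    and H: "predictable F H"
    and Z: "adapted F Z"
    and indep: "\<And>n. 1 \<le> n \<Longrightarrow> indep_of_algebra M (Z n) (F (n - 1))"
    and distr: "\<And>n. 1 \<le> n \<Longrightarrow> distr M borel (Z n) = distr M borel (Z 1)"
    and H2: "(SUP n\<in>{1..}. second_moment M (H n)) < \<infinity>"
    and Z2: "second_moment M (Z 1) < \<infinity>"
  shows "AE \<omega> in M. (\<lambda>n. (\<Sum>k=1..n. H k \<omega> * (Z k \<omega> - expectation (Z 1))) / real n) \<longlonglongrightarrow> 0"
proof -
  define Y where "Y n \<omega> = Z n \<omega> - expectation (Z 1)" for n \<omega>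
  have sub: "subalgebra M (F n)" for n
    using filt by (simp add: filtration_of_def)
  have F_mono: "f \<in> borel_measurable (F j)"
    if "f \<in> borel_measurable (F i)" "i \<le> j" for f :: "'a \<Rightarrow> real" and i j
  proof -
    have "sets (F i) \<subseteq> sets (F j)" "space (F i) = space (F j)"
      using filt sub that(2) by (auto simp: filtration_of_def filtration_def subalgebra_def)
    then show ?thesis
      using that(1) by (auto simp: measurable_def)
  qed
  have HF: "H n \<in> borel_measurable (F (n - 1))" and ZF: "Z n \<in> borel_measurable (F n)" if "1 \<le> n" for n
    using H Z that by (auto simp: predictable_def adapted_def)
  have HM: "H n \<in> borel_measurable M" and ZM: "Z n \<in> borel_measurable M" if "1 \<le> n" for n
    using measurable_from_subalg[OF sub HF[OF that]] measurable_from_subalg[OF sub ZF[OF that]] .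
  have YM: "Y n \<in> borel_measurable M" if "1 \<le> n" for n
    unfolding Y_def using ZM[OF that] by simp
  have Hint: "integrable M (\<lambda>\<omega>. (H n \<omega>)\<^sup>2)"
    and Hbound: "(\<integral>\<omega>. (H n \<omega>)\<^sup>2 \<partial>M) \<le> enn2real (SUP n\<in>{1..}. second_moment M (H n))" if n: "1 \<le> n" for n
  proof -
    have le: "second_moment M (H n) \<le> (SUP n\<in>{1..}. second_moment M (H n))"
      using n by (intro SUP_upper) auto
    show "integrable M (\<lambda>\<omega>. (H n \<omega>)\<^sup>2)"
      using le_less_trans[OF le H2] second_moment_finite_iff[OF HM[OF n]] by blast
    have "(\<integral>\<omega>. (H n \<omega>)\<^sup>2 \<partial>M) = enn2real (second_moment M (H n))"
      unfolding second_moment_def using HM[OF n] by (intro integral_eq_nn_integral) auto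
    \<comment> \<open>\<open>enn2real\<close> sends infinity to 0, so it preserves this inequality
      only because \<open>H2\<close> makes the supremum finite.\<close>
    also have "\<dots> \<le> enn2real (SUP n\<in>{1..}. second_moment M (H n))"
      using le H2 by (intro enn2real_mono) auto
    finally show "(\<integral>\<omega>. (H n \<omega>)\<^sup>2 \<partial>M) \<le> enn2real (SUP n\<in>{1..}. second_moment M (H n))" .
  qed
  \<comment> \<open>Integrability and expectation depend only on the law, so every moment can be
    computed at time 1.\<close>
  have transfer: "integrable M (\<lambda>\<omega>. f (Z n \<omega>)) \<longleftrightarrow> integrable M (\<lambda>\<omega>. f (Z 1 \<omega>))"
    "expectation (\<lambda>\<omega>. f (Z n \<omega>)) = expectation (\<lambda>\<omega>. f (Z 1 \<omega>))"
    if n: "1 \<le> n" and f: "f \<in> borel_measurable borel" for f :: "real \<Rightarrow> real" and n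
    using integrable_distr_eq[OF ZM[OF n] f] integrable_distr_eq[OF ZM[OF order_refl] f]
      integral_distr[OF ZM[OF n] f] integral_distr[OF ZM[OF order_refl] f]
    unfolding distr[OF n] by simp_all
  have Z1_sq: "integrable M (\<lambda>\<omega>. (Z 1 \<omega>)\<^sup>2)"
    using Z2 second_moment_finite_iff[OF ZM[OF order_refl]] by blast
  then have Z1_int: "integrable M (Z 1)"
    by (rule square_integrable_imp_integrable[OF ZM[OF order_refl]])
  have Y1_sq: "integrable M (\<lambda>\<omega>. (Y 1 \<omega>)\<^sup>2)"
    unfolding Y_def power2_diff using Z1_sq Z1_int by auto
  have Yint: "integrable M (Y n)" and Ysq: "integrable M (\<lambda>\<omega>. (Y n \<omega>)\<^sup>2)"
    and Ymean: "expectation (Y n) = 0"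
    and Yvar: "expectation (\<lambda>\<omega>. (Y n \<omega>)\<^sup>2) = expectation (\<lambda>\<omega>. (Y 1 \<omega>)\<^sup>2)" if n: "1 \<le> n" for n
  proof -
    have Zn: "integrable M (Z n)"
      using transfer(1)[OF n, of "\<lambda>z. z"] Z1_int by simp
    then show "integrable M (Y n)"
      unfolding Y_def by auto
    show "integrable M (\<lambda>\<omega>. (Y n \<omega>)\<^sup>2)"
      using transfer(1)[OF n, of "\<lambda>z. (z - expectation (Z 1))\<^sup>2"] Y1_sq unfolding Y_def by simp
    show "expectation (Y n) = 0"
      unfolding Y_def using transfer(2)[OF n, of "\<lambda>z. z"] Zn by (simp add: prob_space)
    show "expectation (\<lambda>\<omega>. (Y n \<omega>)\<^sup>2) = expectation (\<lambda>\<omega>. (Y 1 \<omega>)\<^sup>2)"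
      unfolding Y_def using transfer(2)[OF n, of "\<lambda>z. (z - expectation (Z 1))\<^sup>2"] by simp
  qed
  \<comment> \<open>\<open>U\<close> and \<open>g\<close> are left free for two uses: both squares
    for the second moments, and a product of past factors with the identity for the
    orthogonality.\<close>
  have indepY: "indep_var borel U borel (\<lambda>\<omega>. g (Y n \<omega>))"
    if n: "1 \<le> n" and U: "U \<in> borel_measurable (F (n - 1))" and g: "g \<in> borel_measurable borel"
    for U :: "'a \<Rightarrow> real" and g :: "real \<Rightarrow> real" and n
  proof -
    have g': "(\<lambda>z. g (z - expectation (Z 1))) \<in> borel_measurable borel"
      using g by simp
    show ?thesis
      unfolding Y_def
      using indep_var_of_algebra[OF indep_of_algebra_comp[OF prob_space_axioms indep[OF n] g'] sub U]
        measurable_compose[OF ZM[OF n] g'] .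
  qed
  \<comment> \<open>Independence makes the expectation of the product of squares factor, so second
    moments suffice where Cauchy-Schwarz would call for fourth moments.\<close>
  have sq: "integrable M (\<lambda>\<omega>. (H n \<omega> * Y n \<omega>)\<^sup>2)"
    "expectation (\<lambda>\<omega>. (H n \<omega> * Y n \<omega>)\<^sup>2)
      \<le> enn2real (SUP n\<in>{1..}. second_moment M (H n)) * expectation (\<lambda>\<omega>. (Y 1 \<omega>)\<^sup>2)"
    if n: "1 \<le> n" for n
  proof -
    have iv: "indep_var borel (\<lambda>\<omega>. (H n \<omega>)\<^sup>2) borel (\<lambda>\<omega>. (Y n \<omega>)\<^sup>2)"
      using HF[OF n] by (intro indepY n) auto
    show "integrable M (\<lambda>\<omega>. (H n \<omega> * Y n \<omega>)\<^sup>2)"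
      unfolding power_mult_distrib by (rule indep_var_integrable[OF iv Hint[OF n] Ysq[OF n]])
    have "expectation (\<lambda>\<omega>. (H n \<omega> * Y n \<omega>)\<^sup>2)
        = expectation (\<lambda>\<omega>. (H n \<omega>)\<^sup>2) * expectation (\<lambda>\<omega>. (Y 1 \<omega>)\<^sup>2)"
      unfolding power_mult_distrib indep_var_lebesgue_integral[OF iv Hint[OF n] Ysq[OF n]] Yvar[OF n] ..
    also have "\<dots> \<le> enn2real (SUP n\<in>{1..}. second_moment M (H n)) * expectation (\<lambda>\<omega>. (Y 1 \<omega>)\<^sup>2)"
      by (intro mult_right_mono Hbound n) simp
    finally show "expectation (\<lambda>\<omega>. (H n \<omega> * Y n \<omega>)\<^sup>2)
      \<le> enn2real (SUP n\<in>{1..}. second_moment M (H n)) * expectation (\<lambda>\<omega>. (Y 1 \<omega>)\<^sup>2)" .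
  qed
  have "AE \<omega> in M. (\<lambda>n. (\<Sum>k=1..n. H k \<omega> * Y k \<omega>) / real n) \<longlonglongrightarrow> 0"
  proof (rule orthogonal_strong_law)
    show "integrable M (\<lambda>\<omega>. H i \<omega> * Y i \<omega> * (H j \<omega> * Y j \<omega>))" if "1 \<le> i" "1 \<le> j" for i j
      using sq(1) HM YM that by (intro integrable_mult_of_square_integrable borel_measurable_times)
    show "expectation (\<lambda>\<omega>. H i \<omega> * Y i \<omega> * (H j \<omega> * Y j \<omega>)) = 0" if ij: "1 \<le> i" "i < j" for i j
    proof -
      have "H i \<in> borel_measurable (F (j - 1))" "Y i \<in> borel_measurable (F (j - 1))"
        "H j \<in> borel_measurable (F (j - 1))"
        using F_mono[OF HF] F_mono[OF ZF] HF[of j] ij unfolding Y_def by simp_all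
      \<comment> \<open>Since i is at most j - 1, every factor except \<open>Y j\<close> is known at
        time j - 1; the expectation therefore contains the factor E[\<open>Y j\<close>] = 0.\<close>
      then have iv: "indep_var borel (\<lambda>\<omega>. H i \<omega> * Y i \<omega> * H j \<omega>) borel (Y j)"
        using ij by (intro indepY[of j _ "\<lambda>z. z"] borel_measurable_times) simp_all
      \<comment> \<open>The triple product is grouped as (\<open>H i\<close> times
        \<open>Y i\<close>) times \<open>H j\<close>, a product of two square-integrable
        functions.\<close>
      have int: "integrable M (\<lambda>\<omega>. H i \<omega> * Y i \<omega> * H j \<omega>)"
        using ij by (intro integrable_mult_of_square_integrable borel_measurable_times sq(1) Hint HM YM) simp_all
      show ?thesis
        using indep_var_lebesgue_integral[OF iv int Yint] Ymean[of j] ij by (simp add: mult.assoc)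
    qed
    show "expectation (\<lambda>\<omega>. (H n \<omega> * Y n \<omega>)\<^sup>2)
      \<le> enn2real (SUP n\<in>{1..}. second_moment M (H n)) * expectation (\<lambda>\<omega>. (Y 1 \<omega>)\<^sup>2)" if "1 \<le> n" for n
      using sq(2)[OF that] .
  qed
  then show ?thesis
    by (simp add: Y_def)
qed

section \<open>Limits of ratios of weighted sums\<close>

text \<open>With \<open>A\<close> the average weight, numerator and denominator over n are
  \<open>U\<close> + p \<open>A\<close> and \<open>V\<close> + q \<open>A\<close>. In the difference
  from p / q the terms p q \<open>A\<close> cancel in the numerator, so \<open>A\<close> need not
  converge: a positive lower bound keeps the denominator away from 0.\<close>

lemma weighted_ratio_tendsto:
  fixes h z b :: "nat \<Rightarrow> real"
  assumes z: "(\<lambda>n. (\<Sum>k=1..n. h k * (z k - p)) / real n) \<longlonglongrightarrow> 0"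
    and b: "(\<lambda>n. (\<Sum>k=1..n. h k * (b k - q)) / real n) \<longlonglongrightarrow> 0"
    and h: "liminf (\<lambda>n. ereal ((1 / real n) * (\<Sum>k=1..n. h k))) > 0"
    and q: "0 < q"
  shows "(\<lambda>n. (\<Sum>k=1..n. h k * z k) / (\<Sum>k=1..n. h k * b k)) \<longlonglongrightarrow> p / q"
proof -
  define U where "U n = (\<Sum>k=1..n. h k * (z k - p)) / real n" for n
  define V where "V n = (\<Sum>k=1..n. h k * (b k - q)) / real n" for n
  define A where "A n = (1 / real n) * (\<Sum>k=1..n. h k)" for n
  \<comment> \<open>The liminf may be infinite, so a real number strictly below it is
    chosen.\<close>
  obtain c where c: "0 < ereal c" "ereal c < liminf (\<lambda>n. ereal (A n))"
    using ereal_dense2[OF h] unfolding A_def by auto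
  have A: "\<forall>\<^sub>F n in sequentially. c < A n"
    using less_LiminfD[OF c(2)] by simp
  have "(\<lambda>n. \<bar>q * U n - p * V n\<bar> / (q * (q * c / 2))) \<longlonglongrightarrow> \<bar>q * 0 - p * 0\<bar> / (q * (q * c / 2))"
    using z b c q unfolding U_def V_def by (intro tendsto_intros) auto
  then have lim: "(\<lambda>n. \<bar>q * U n - p * V n\<bar> / (q * (q * c / 2))) \<longlonglongrightarrow> 0"
    by simp
  \<comment> \<open>Half of the margin q c is reserved for \<open>V\<close>, leaving at least q c /
    2 for the denominator.\<close>
  have V: "\<forall>\<^sub>F n in sequentially. - (q * c / 2) < V n"
    using b c q unfolding V_def by (intro order_tendstoD(1)) auto
  have "\<forall>\<^sub>F n in sequentially. norm ((\<Sum>k=1..n. h k * z k) / (\<Sum>k=1..n. h k * b k) - p / q)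
      \<le> \<bar>q * U n - p * V n\<bar> / (q * (q * c / 2))"
    using A V eventually_gt_at_top[of 0]
  proof eventually_elim
    fix n :: nat assume A: "c < A n" and V: "- (q * c / 2) < V n" and n: "0 < n"
    have split: "(\<Sum>k=1..n. h k * w k) = real n * ((\<Sum>k=1..n. h k * (w k - r)) / real n + r * A n)" for w r
    proof -
      have "(\<Sum>k=1..n. h k * w k) = (\<Sum>k=1..n. h k * (w k - r)) + r * (\<Sum>k=1..n. h k)"
        unfolding sum_distrib_left sum.distrib[symmetric] by (simp add: algebra_simps)
      also have "\<dots> = real n * ((\<Sum>k=1..n. h k * (w k - r)) / real n + r * A n)"
        using n by (simp add: A_def distrib_left)
      finally show ?thesis .
    qed
    note num = split[of z p, folded U_def] and den = split[of b q, folded V_def]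
    have "q * c < q * A n"
      using A q by simp
    then have le: "q * c / 2 \<le> V n + q * A n"
      using V by linarith
    have pos: "0 < q * c / 2"
      using c q by simp
    have "(\<Sum>k=1..n. h k * z k) / (\<Sum>k=1..n. h k * b k) - p / q
        = (q * U n - p * V n) / (q * (V n + q * A n))"
      unfolding num den using n q le pos by (simp add: divide_simps) (simp add: algebra_simps)
    also have "norm \<dots> = \<bar>q * U n - p * V n\<bar> / (q * (V n + q * A n))"
      using q le pos by (simp add: abs_mult)
    also have "\<dots> \<le> \<bar>q * U n - p * V n\<bar> / (q * (q * c / 2))"
      using q le pos by (intro divide_left_mono mult_left_mono mult_pos_pos) auto
    finally show "norm ((\<Sum>k=1..n. h k * z k) / (\<Sum>k=1..n. h k * b k) - p / q)
      \<le> \<bar>q * U n - p * V n\<bar> / (q * (q * c / 2))" .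
  qed
  then show ?thesis
    using lim by (subst LIM_zero_iff[symmetric]) (rule Lim_null_comparison)
qed

section \<open>Cumulative return and profit per unit bet\<close>

theorem corollary7p2:
  fixes M :: "'a measure"
    and F :: "nat \<Rightarrow> 'a measure"
    and Bs Bo Ro Xo B R X :: "nat \<Rightarrow> 'a \<Rightarrow> real"
  assumes "prob_space M"
    and "filtration_of M F"
    and "predictable F Bs"
    and "\<And>n. n \<ge> 1 \<Longrightarrow> AE \<omega> in M. Bs n \<omega> \<ge> 0"
    and "\<And>n. n \<ge> 1 \<Longrightarrow> AE \<omega> in M. Bo n \<omega> \<ge> 1"
    and "\<And>n. n \<ge> 1 \<Longrightarrow> AE \<omega> in M. Ro n \<omega> \<ge> 0"
    and "\<And>n \<omega>. n \<ge> 1 \<Longrightarrow> \<omega> \<in> space M \<Longrightarrow> Xo n \<omega> = Ro n \<omega> - Bo n \<omega>"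
    and "iid M (\<lambda>n \<omega>. (Bo n \<omega>, Ro n \<omega>))"
    and "iid M (\<lambda>n \<omega>. (Bo n \<omega>, Xo n \<omega>))"
    and "adapted F (\<lambda>n \<omega>. (Bo n \<omega>, Ro n \<omega>))"
    and "adapted F (\<lambda>n \<omega>. (Bo n \<omega>, Xo n \<omega>))"
    and "\<And>n. n \<ge> 1 \<Longrightarrow> indep_of_algebra M (\<lambda>\<omega>. (Bo n \<omega>, Ro n \<omega>)) (F (n - 1))"
    and "\<And>n. n \<ge> 1 \<Longrightarrow> indep_of_algebra M (\<lambda>\<omega>. (Bo n \<omega>, Xo n \<omega>)) (F (n - 1))"
    and "\<And>n \<omega>. n \<ge> 1 \<Longrightarrow> \<omega> \<in> space M \<Longrightarrow> B n \<omega> = Bs n \<omega> * Bo n \<omega>"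
    and "\<And>n \<omega>. n \<ge> 1 \<Longrightarrow> \<omega> \<in> space M \<Longrightarrow> R n \<omega> = Bs n \<omega> * Ro n \<omega>"
    and "\<And>n \<omega>. n \<ge> 1 \<Longrightarrow> \<omega> \<in> space M \<Longrightarrow> X n \<omega> = Bs n \<omega> * Xo n \<omega>"
    and "(SUP n\<in>{1..}. second_moment M (Bs n)) < \<infinity>"
    and "AE \<omega> in M. liminf (\<lambda>n. ereal ((1 / real n) * (\<Sum>k=1..n. Bs k \<omega>))) > 0"
    and "second_moment M (Bo 1) < \<infinity>"
  shows "(second_moment M (Ro 1) < \<infinity> \<longleftrightarrow> second_moment M (Xo 1) < \<infinity>) \<and>
    (second_moment M (Ro 1) < \<infinity> \<longrightarrow>
      (AE \<omega> in M. (\<lambda>n. cumulative_ratio R B n \<omega>) \<longlonglongrightarrow> RTP M (Bo 1) (Ro 1)) \<and>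
      (AE \<omega> in M. (\<lambda>n. cumulative_ratio X B n \<omega>) \<longlonglongrightarrow> - HA M (Bo 1) (Xo 1)))"
proof -
  interpret prob_space M by fact
  have sub: "subalgebra M (F n)" for n
    using assms(2) by (simp add: filtration_of_def)
  \<comment> \<open>Stated for a general pair process and Borel \<open>f\<close> to serve three
    times: both coordinates of (\<open>Bo\<close>, \<open>Ro\<close>) and the second coordinate of
    (\<open>Bo\<close>, \<open>Xo\<close>).\<close>
  have law: "AE \<omega> in M. (\<lambda>n. (\<Sum>k=1..n. Bs k \<omega> * (f (P k \<omega>) - expectation (\<lambda>\<omega>. f (P 1 \<omega>)))) / real n) \<longlonglongrightarrow> 0"
    if P: "iid M P" "adapted F P" "\<And>n. n \<ge> 1 \<Longrightarrow> indep_of_algebra M (P n) (F (n - 1))"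
      and f: "f \<in> borel_measurable borel" and fin: "second_moment M (\<lambda>\<omega>. f (P 1 \<omega>)) < \<infinity>"
    for P :: "nat \<Rightarrow> 'a \<Rightarrow> real \<times> real" and f :: "real \<times> real \<Rightarrow> real"
  proof (rule strong_law_predictable_multiplier[where Z = "\<lambda>n \<omega>. f (P n \<omega>)"])
    have PF: "P n \<in> borel_measurable (F n)" if "1 \<le> n" for n
      using P(2) that by (simp add: adapted_def)
    show "filtration_of M F" "predictable F Bs" "(SUP n\<in>{1..}. second_moment M (Bs n)) < \<infinity>"
      "second_moment M (\<lambda>\<omega>. f (P 1 \<omega>)) < \<infinity>"
      by fact+
    show "adapted F (\<lambda>n \<omega>. f (P n \<omega>))"
      unfolding adapted_def using measurable_compose[OF PF f] by auto
    show "indep_of_algebra M (\<lambda>\<omega>. f (P n \<omega>)) (F (n - 1))" if "1 \<le> n" for n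
      using indep_of_algebra_comp[OF assms(1) P(3)[OF that] f] .
    show "distr M borel (\<lambda>\<omega>. f (P n \<omega>)) = distr M borel (\<lambda>\<omega>. f (P 1 \<omega>))" if n: "1 \<le> n" for n
    proof -
      have "distr M borel (P n) = distr M borel (P 1)"
        using P(1) n unfolding iid_def by blast
      then have "distr (distr M borel (P n)) borel f = distr (distr M borel (P 1)) borel f"
        by (rule arg_cong)
      then show ?thesis
        using f measurable_from_subalg[OF sub PF[OF n]] measurable_from_subalg[OF sub PF[of 1]]
        by (simp add: distr_distr comp_def)
    qed
  qed
  have f_meas: "fst \<in> borel_measurable (borel :: (real \<times> real) measure)"
    "snd \<in> borel_measurable (borel :: (real \<times> real) measure)"
    by (rule borel_measurable_continuous_onI, intro continuous_intros)+
  have "(\<lambda>\<omega>. (Bo 1 \<omega>, Ro 1 \<omega>)) \<in> borel_measurable (F 1)"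
    "(\<lambda>\<omega>. (Bo 1 \<omega>, Xo 1 \<omega>)) \<in> borel_measurable (F 1)"
    using assms(10,11) by (simp_all add: adapted_def)
  note pair_meas = this[THEN measurable_from_subalg[OF sub]]
  have meas: "Bo 1 \<in> borel_measurable M" "Ro 1 \<in> borel_measurable M" "Xo 1 \<in> borel_measurable M"
    using measurable_compose[OF pair_meas(1) f_meas(1)] measurable_compose[OF pair_meas(1) f_meas(2)]
      measurable_compose[OF pair_meas(2) f_meas(2)] by simp_all
  have B2: "integrable M (\<lambda>\<omega>. (Bo 1 \<omega>)\<^sup>2)"
    using assms(19) second_moment_finite_iff[OF meas(1)] by simp
  \<comment> \<open>Expand the squares of \<open>Ro\<close> - \<open>Bo\<close> and of
    \<open>Xo\<close> + \<open>Bo\<close>; the cross terms are integrable because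
    \<open>Bo 1\<close> is square-integrable as well.\<close>
  have equiv: "second_moment M (Ro 1) < \<infinity> \<longleftrightarrow> second_moment M (Xo 1) < \<infinity>"
    unfolding second_moment_finite_iff[OF meas(2)] second_moment_finite_iff[OF meas(3)]
  proof
    assume R2: "integrable M (\<lambda>\<omega>. (Ro 1 \<omega>)\<^sup>2)"
    have "integrable M (\<lambda>\<omega>. (Ro 1 \<omega>)\<^sup>2 + (Bo 1 \<omega>)\<^sup>2 - 2 * (Ro 1 \<omega> * Bo 1 \<omega>))"
      using R2 B2 integrable_mult_of_square_integrable[OF meas(2,1) R2 B2] by auto
    moreover have "(Xo 1 \<omega>)\<^sup>2 = (Ro 1 \<omega>)\<^sup>2 + (Bo 1 \<omega>)\<^sup>2 - 2 * (Ro 1 \<omega> * Bo 1 \<omega>)"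
      if "\<omega> \<in> space M" for \<omega>
      unfolding assms(7)[OF order_refl that] by (simp add: power2_diff)
    ultimately show "integrable M (\<lambda>\<omega>. (Xo 1 \<omega>)\<^sup>2)"
      by (subst Bochner_Integration.integrable_cong[OF refl]) assumption+
  next
    assume X2: "integrable M (\<lambda>\<omega>. (Xo 1 \<omega>)\<^sup>2)"
    have "integrable M (\<lambda>\<omega>. (Xo 1 \<omega>)\<^sup>2 + (Bo 1 \<omega>)\<^sup>2 + 2 * (Xo 1 \<omega> * Bo 1 \<omega>))"
      using X2 B2 integrable_mult_of_square_integrable[OF meas(3,1) X2 B2] by auto
    moreover have "(Ro 1 \<omega>)\<^sup>2 = (Xo 1 \<omega>)\<^sup>2 + (Bo 1 \<omega>)\<^sup>2 + 2 * (Xo 1 \<omega> * Bo 1 \<omega>)"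
      if "\<omega> \<in> space M" for \<omega>
      unfolding assms(7)[OF order_refl that] by (simp add: power2_eq_square algebra_simps)
    ultimately show "integrable M (\<lambda>\<omega>. (Ro 1 \<omega>)\<^sup>2)"
      by (subst Bochner_Integration.integrable_cong[OF refl]) assumption+
  qed
  \<comment> \<open>A unit base bet stakes at least one unit almost surely, which gives the positive
    q of \<open>weighted_ratio_tendsto\<close>.\<close>
  have "1 \<le> expectation (Bo 1)"
    using assms(5)[of 1] square_integrable_imp_integrable[OF meas(1) B2]
    by (intro integral_ge_const) auto
  then have pos: "0 < expectation (Bo 1)"
    by simp
  have law_B: "AE \<omega> in M. (\<lambda>n. (\<Sum>k=1..n. Bs k \<omega> * (Bo k \<omega> - expectation (Bo 1))) / real n) \<longlonglongrightarrow> 0"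
    using law[OF assms(8,10,12) f_meas(1)] assms(19) unfolding fst_conv by blast
  \<comment> \<open>The deterministic lemma is applied path by path. \<open>AE_space\<close> enters
    because the product formulas for the bets and payoffs are assumed only on
    \<open>space M\<close>.\<close>
  have ratio: "AE \<omega> in M. (\<lambda>n. cumulative_ratio A B n \<omega>) \<longlonglongrightarrow> expectation (Zo 1) / expectation (Bo 1)"
    if Zo: "AE \<omega> in M. (\<lambda>n. (\<Sum>k=1..n. Bs k \<omega> * (Zo k \<omega> - expectation (Zo 1))) / real n) \<longlonglongrightarrow> 0"
      and A: "\<And>n \<omega>. n \<ge> 1 \<Longrightarrow> \<omega> \<in> space M \<Longrightarrow> A n \<omega> = Bs n \<omega> * Zo n \<omega>"
    for A Zo :: "nat \<Rightarrow> 'a \<Rightarrow> real"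
    using Zo law_B assms(18) AE_space
  proof eventually_elim
    case (elim \<omega>)
    have "(\<Sum>k=1..n. A k \<omega>) = (\<Sum>k=1..n. Bs k \<omega> * Zo k \<omega>)"
      "(\<Sum>k=1..n. B k \<omega>) = (\<Sum>k=1..n. Bs k \<omega> * Bo k \<omega>)" for n
      using A assms(14) elim(4) by (auto intro!: sum.cong)
    then show ?case
      unfolding cumulative_ratio_def using weighted_ratio_tendsto[OF elim(1,2,3) pos] by presburger
  qed
  show ?thesis
  proof (intro conjI impI equiv)
    assume R2: "second_moment M (Ro 1) < \<infinity>"
    show "AE \<omega> in M. (\<lambda>n. cumulative_ratio R B n \<omega>) \<longlonglongrightarrow> RTP M (Bo 1) (Ro 1)"
      unfolding RTP_def
      by (rule ratio[OF law[OF assms(8,10,12) f_meas(2), unfolded snd_conv, OF _ R2] assms(15)])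
    have X2: "second_moment M (Xo 1) < \<infinity>"
      using R2 equiv by blast
    \<comment> \<open>The minus sign in \<open>HA\<close> cancels, so the target is the quotient of
      expectations as before.\<close>
    show "AE \<omega> in M. (\<lambda>n. cumulative_ratio X B n \<omega>) \<longlonglongrightarrow> - HA M (Bo 1) (Xo 1)"
      unfolding HA_def minus_minus
      by (rule ratio[OF law[OF assms(9,11,13) f_meas(2), unfolded snd_conv, OF _ X2] assms(16)])
  qed
qed

end
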